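(* Let $R$ be a finite-dimensional algebra over a field $K$ such that $R^*$ is an invertible $R$-bimodule and $[R^*]$ has order at most $2$ in $\mathrm{Pic}(R)$ (equivalently, $R^*\otimes_R R^*\simeq R$ as $R$-bimodules). Then any isomorphism of $R$-bimodules $\psi:R^*\otimes_R R^*\to R$ is associative, i.e. $\psi(r^*\otimes_R s^* )\rightharpoonup t^*=r^*\leftharpoonup\psi(s^*\otimes_R t^* )$ for all $r^*,s^*,t^*\in R^*$.
   Context: Algebras are associative unital $K$-algebras, and bimodules are bimodules on which $K$ acts centrally. $R^*=\mathrm{Hom}_K(R,K)$ is an $R$-bimodule by $(r\rightharpoonup r^* )(a)=r^*(ar)$ and $(r^*\leftharpoonup r)(a)=r^*(ra)$. An $R$-bimodule $P$ is invertible if there is an $R$-bimodule $Q$ with $P\otimes_R Q\simeq R\simeq Q\otimes_R P$ as bimodules; $\mathrm{Pic}(R)$ is the group of isomorphism classes $[P]$ of invertible $R$-bimodules, with $[U][V]=[U\otimes_R V]$. *)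

theory Defs
  imports
    "HOL-Algebra.Free_Abelian_Groups"
    "Jordan_Normal_Form.Missing_VectorSpace"
begin

section \<open>Algebras and bimodules\<close>

text \<open>HOL-Algebra's locale \<^locale>\<open>algebra\<close> demands a commutative multiplication.\<close>

locale unital_algebra = vectorspace K R + ring R for K and R (structure) +
  assumes smult_mult_left:
      "\<lbrakk>c \<in> carrier K; x \<in> carrier R; y \<in> carrier R\<rbrakk> \<Longrightarrow> (c \<odot> x) \<otimes> y = c \<odot> (x \<otimes> y)"
    and smult_mult_right:
      "\<lbrakk>c \<in> carrier K; x \<in> carrier R; y \<in> carrier R\<rbrakk> \<Longrightarrow> x \<otimes> (c \<odot> y) = c \<odot> (x \<otimes> y)"

text \<open>As for \<^typ>\<open>('a, 'b) module\<close>, the fields \<^const>\<open>monoid.mult\<close> and \<^const>\<open>monoid.one\<close>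
  of a bimodule record carry no meaning.\<close>

record ('r, 'm) bimodule = "'m ring" +
  lact :: "'r \<Rightarrow> 'm \<Rightarrow> 'm"  (infixr \<open>\<rightharpoonup>\<index>\<close> 70)
  ract :: "'m \<Rightarrow> 'r \<Rightarrow> 'm"  (infixl \<open>\<leftharpoonup>\<index>\<close> 70)

text \<open>The \<open>K\<close>-vector space structure of a bimodule is the one induced by
  \<open>c \<mapsto> c \<odot>\<^bsub>R\<^esub> \<one>\<^bsub>R\<^esub>\<close>, which is why it is not a component of the record.\<close>

locale bimodule = A?: unital_algebra K R + M?: abelian_group M
  for K and R :: "('k, 'r, 'a) module_scheme" and M :: "('r, 'm) bimodule" (structure) +
  assumes lact_closed:
      "\<lbrakk>r \<in> carrier R; m \<in> carrier M\<rbrakk> \<Longrightarrow> r \<rightharpoonup> m \<in> carrier M"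
    and lact_add_left:
      "\<lbrakk>r \<in> carrier R; s \<in> carrier R; m \<in> carrier M\<rbrakk>
        \<Longrightarrow> (r \<oplus>\<^bsub>R\<^esub> s) \<rightharpoonup> m = (r \<rightharpoonup> m) \<oplus> (s \<rightharpoonup> m)"
    and lact_add_right:
      "\<lbrakk>r \<in> carrier R; m \<in> carrier M; n \<in> carrier M\<rbrakk>
        \<Longrightarrow> r \<rightharpoonup> (m \<oplus> n) = (r \<rightharpoonup> m) \<oplus> (r \<rightharpoonup> n)"
    and lact_mult:
      "\<lbrakk>r \<in> carrier R; s \<in> carrier R; m \<in> carrier M\<rbrakk>
        \<Longrightarrow> (r \<otimes>\<^bsub>R\<^esub> s) \<rightharpoonup> m = r \<rightharpoonup> (s \<rightharpoonup> m)"
    and lact_one: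
      "m \<in> carrier M \<Longrightarrow> \<one>\<^bsub>R\<^esub> \<rightharpoonup> m = m"
    and ract_closed:
      "\<lbrakk>r \<in> carrier R; m \<in> carrier M\<rbrakk> \<Longrightarrow> m \<leftharpoonup> r \<in> carrier M"
    and ract_add_left:
      "\<lbrakk>r \<in> carrier R; m \<in> carrier M; n \<in> carrier M\<rbrakk>
        \<Longrightarrow> (m \<oplus> n) \<leftharpoonup> r = (m \<leftharpoonup> r) \<oplus> (n \<leftharpoonup> r)"
    and ract_add_right:
      "\<lbrakk>r \<in> carrier R; s \<in> carrier R; m \<in> carrier M\<rbrakk>
        \<Longrightarrow> m \<leftharpoonup> (r \<oplus>\<^bsub>R\<^esub> s) = (m \<leftharpoonup> r) \<oplus> (m \<leftharpoonup> s)"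
    and ract_mult:
      "\<lbrakk>r \<in> carrier R; s \<in> carrier R; m \<in> carrier M\<rbrakk>
        \<Longrightarrow> m \<leftharpoonup> (r \<otimes>\<^bsub>R\<^esub> s) = (m \<leftharpoonup> r) \<leftharpoonup> s"
    and ract_one:
      "m \<in> carrier M \<Longrightarrow> m \<leftharpoonup> \<one>\<^bsub>R\<^esub> = m"
    and lact_ract:
      "\<lbrakk>r \<in> carrier R; s \<in> carrier R; m \<in> carrier M\<rbrakk>
        \<Longrightarrow> (r \<rightharpoonup> m) \<leftharpoonup> s = r \<rightharpoonup> (m \<leftharpoonup> s)"
    and central:
      "\<lbrakk>c \<in> carrier K; m \<in> carrier M\<rbrakk>
        \<Longrightarrow> (c \<odot>\<^bsub>R\<^esub> \<one>\<^bsub>R\<^esub>) \<rightharpoonup> m = m \<leftharpoonup> (c \<odot>\<^bsub>R\<^esub> \<one>\<^bsub>R\<^esub>)"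

definition bimodule_hom ::
    "('r, 'a) ring_scheme \<Rightarrow> ('r, 'm) bimodule \<Rightarrow> ('r, 'n) bimodule \<Rightarrow> ('m \<Rightarrow> 'n) set" where
  "bimodule_hom R M N = {f \<in> carrier M \<rightarrow> carrier N.
     (\<forall>x \<in> carrier M. \<forall>y \<in> carrier M. f (x \<oplus>\<^bsub>M\<^esub> y) = f x \<oplus>\<^bsub>N\<^esub> f y) \<and>
     (\<forall>r \<in> carrier R. \<forall>x \<in> carrier M. f (r \<rightharpoonup>\<^bsub>M\<^esub> x) = r \<rightharpoonup>\<^bsub>N\<^esub> f x) \<and>
     (\<forall>r \<in> carrier R. \<forall>x \<in> carrier M. f (x \<leftharpoonup>\<^bsub>M\<^esub> r) = f x \<leftharpoonup>\<^bsub>N\<^esub> r)}"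

definition bimodule_iso ::
    "('r, 'a) ring_scheme \<Rightarrow> ('r, 'm) bimodule \<Rightarrow> ('r, 'n) bimodule \<Rightarrow> ('m \<Rightarrow> 'n) set" where
  "bimodule_iso R M N = {f \<in> bimodule_hom R M N. bij_betw f (carrier M) (carrier N)}"

definition bimodule_isomorphic ::
    "('r, 'a) ring_scheme \<Rightarrow> ('r, 'm) bimodule \<Rightarrow> ('r, 'n) bimodule \<Rightarrow> bool" where
  "bimodule_isomorphic R M N \<longleftrightarrow> bimodule_iso R M N \<noteq> {}"

definition regular_bimodule :: "('r, 'a) ring_scheme \<Rightarrow> ('r, 'r) bimodule" where
  "regular_bimodule R = \<lparr>carrier = carrier R, mult = mult R, one = one R, zero = zero R,
     add = add R, lact = mult R, ract = mult R\<rparr>"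

text \<open>Linear functionals are represented by their extensional versions, so that equality of
  elements of the dual is equality of functions.\<close>

definition dual_bimodule ::
    "('k, 'b) ring_scheme \<Rightarrow> ('k, 'r, 'a) module_scheme \<Rightarrow> ('r, 'r \<Rightarrow> 'k) bimodule" where
  "dual_bimodule K R =
    \<lparr>carrier = {f \<in> carrier R \<rightarrow>\<^sub>E carrier K.
        (\<forall>x \<in> carrier R. \<forall>y \<in> carrier R. f (x \<oplus>\<^bsub>R\<^esub> y) = f x \<oplus>\<^bsub>K\<^esub> f y) \<and>
        (\<forall>c \<in> carrier K. \<forall>x \<in> carrier R. f (c \<odot>\<^bsub>R\<^esub> x) = c \<otimes>\<^bsub>K\<^esub> f x)},
     mult = undefined, one = undefined,
     zero = (\<lambda>a \<in> carrier R. \<zero>\<^bsub>K\<^esub>),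
     add = (\<lambda>f g. \<lambda>a \<in> carrier R. f a \<oplus>\<^bsub>K\<^esub> g a),
     lact = (\<lambda>r f. \<lambda>a \<in> carrier R. f (a \<otimes>\<^bsub>R\<^esub> r)),
     ract = (\<lambda>f r. \<lambda>a \<in> carrier R. f (r \<otimes>\<^bsub>R\<^esub> a))\<rparr>"


section \<open>Tensor products over a noncommutative ring\<close>

text \<open>The tensor product over \<open>R\<close> is the free abelian group on the pairs, modulo the subgroup
  generated by biadditivity and \<open>R\<close>-balancedness.\<close>

definition tensor_free ::
    "('r, 'm) bimodule \<Rightarrow> ('r, 'n) bimodule \<Rightarrow> ('m \<times> 'n \<Rightarrow>\<^sub>0 int) monoid" where
  "tensor_free M N = free_Abelian_group (carrier M \<times> carrier N)"

definition tensor_relations ::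
    "('r, 'a) ring_scheme \<Rightarrow> ('r, 'm) bimodule \<Rightarrow> ('r, 'n) bimodule \<Rightarrow> ('m \<times> 'n \<Rightarrow>\<^sub>0 int) set" where
  "tensor_relations R M N =
     {frag_of (x \<oplus>\<^bsub>M\<^esub> x', y) - frag_of (x, y) - frag_of (x', y) | x x' y.
        x \<in> carrier M \<and> x' \<in> carrier M \<and> y \<in> carrier N} \<union>
     {frag_of (x, y \<oplus>\<^bsub>N\<^esub> y') - frag_of (x, y) - frag_of (x, y') | x y y'.
        x \<in> carrier M \<and> y \<in> carrier N \<and> y' \<in> carrier N} \<union>
     {frag_of (x \<leftharpoonup>\<^bsub>M\<^esub> r, y) - frag_of (x, r \<rightharpoonup>\<^bsub>N\<^esub> y) | x r y.
        x \<in> carrier M \<and> r \<in> carrier R \<and> y \<in> carrier N}"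

definition tensor_kernel ::
    "('r, 'a) ring_scheme \<Rightarrow> ('r, 'm) bimodule \<Rightarrow> ('r, 'n) bimodule \<Rightarrow> ('m \<times> 'n \<Rightarrow>\<^sub>0 int) set" where
  "tensor_kernel R M N = generate (tensor_free M N) (tensor_relations R M N)"

text \<open>In the two actions, all members of the union over a coset coincide: the maps
  \<open>x \<otimes> y \<mapsto> (r \<rightharpoonup> x) \<otimes> y\<close> and \<open>x \<otimes> y \<mapsto> x \<otimes> (y \<leftharpoonup> r)\<close> preserve the relations.\<close>

definition tensor ::
    "('r, 'a) ring_scheme \<Rightarrow> ('r, 'm) bimodule \<Rightarrow> ('r, 'n) bimodule
      \<Rightarrow> ('r, ('m \<times> 'n \<Rightarrow>\<^sub>0 int) set) bimodule" where
  "tensor R M N = (let F = tensor_free M N; H = tensor_kernel R M N in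
    \<lparr>carrier = carrier (F Mod H), mult = undefined, one = undefined,
     zero = one (F Mod H), add = mult (F Mod H),
     lact = (\<lambda>r X. \<Union>c \<in> X. H #>\<^bsub>F\<^esub> frag_extend (\<lambda>(x, y). frag_of (r \<rightharpoonup>\<^bsub>M\<^esub> x, y)) c),
     ract = (\<lambda>X r. \<Union>c \<in> X. H #>\<^bsub>F\<^esub> frag_extend (\<lambda>(x, y). frag_of (x, y \<leftharpoonup>\<^bsub>N\<^esub> r)) c)\<rparr>)"

definition tensor_elem ::
    "('r, 'a) ring_scheme \<Rightarrow> ('r, 'm) bimodule \<Rightarrow> ('r, 'n) bimodule
      \<Rightarrow> 'm \<Rightarrow> 'n \<Rightarrow> ('m \<times> 'n \<Rightarrow>\<^sub>0 int) set" where
  "tensor_elem R M N x y = tensor_kernel R M N #>\<^bsub>tensor_free M N\<^esub> frag_of (x, y)"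


section \<open>Invertible bimodules and the Picard group\<close>

text \<open>HOL cannot quantify over all types, so the inverse bimodule and the representatives of
  isomorphism classes are taken with carrier in the type \<^typ>\<open>nat \<Rightarrow> 'k\<close>. For a
  finite-dimensional algebra this loses nothing: an invertible bimodule is finitely generated as
  a right module, hence finite-dimensional over \<open>K\<close>, hence isomorphic to a bimodule whose
  carrier is the copy of \<open>K\<^sup>n\<close> in \<^typ>\<open>nat \<Rightarrow> 'k\<close>.\<close>

definition invertible_bimodule ::
    "('k, 'b) ring_scheme \<Rightarrow> ('k, 'r, 'a) module_scheme \<Rightarrow> ('r, 'm) bimodule \<Rightarrow> bool" where
  "invertible_bimodule K R P \<longleftrightarrow> bimodule K R P \<and>
     (\<exists>Q :: ('r, nat \<Rightarrow> 'k) bimodule. bimodule K R Q \<and>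
        bimodule_isomorphic R (tensor R P Q) (regular_bimodule R) \<and>
        bimodule_isomorphic R (tensor R Q P) (regular_bimodule R))"

definition iso_class ::
    "('k, 'b) ring_scheme \<Rightarrow> ('k, 'r, 'a) module_scheme \<Rightarrow> ('r, 'm) bimodule
      \<Rightarrow> ('r, nat \<Rightarrow> 'k) bimodule set" where
  "iso_class K R P = {W. bimodule K R W \<and> bimodule_isomorphic R P W}"

text \<open>For classes \<open>X = [U]\<close> and \<open>Y = [V]\<close> the union below has the single member
  \<open>[U \<otimes>\<^sub>R V]\<close>, whichever representatives are used.\<close>

definition Pic ::
    "('k, 'b) ring_scheme \<Rightarrow> ('k, 'r, 'a) module_scheme
      \<Rightarrow> ('r, nat \<Rightarrow> 'k) bimodule set monoid" where
  "Pic K R =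
    \<lparr>carrier = {iso_class K R P | P :: ('r, nat \<Rightarrow> 'k) bimodule. invertible_bimodule K R P},
     mult = (\<lambda>X Y. \<Union>U \<in> X. \<Union>V \<in> Y. iso_class K R (tensor R U V)),
     one = iso_class K R (regular_bimodule R)\<rparr>"

end

theory Submission
  imports Defs
begin

text \<open>
  Write \<open>D = R\<^sup>*\<close> and \<open>\<phi>(r, s) = \<psi>(r \<otimes> s)\<close>. Since \<open>\<psi>\<close> is an isomorphism, the two bimodule isomorphisms
  \<open>D \<otimes> D \<otimes> D \<rightarrow> D\<close> to be compared differ by a bimodule endomorphism of \<open>D\<close>. By finite-dimensional
  duality this is multiplication by a central element \<open>u\<close> of \<open>R\<close>, so that
  \<open>\<phi>(r, s) t = u r \<phi>(s, t)\<close>. Central elements act on \<open>D\<close> equally from both sides, so evaluating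
  \<open>\<phi>(\<phi>(r, s) t, w) = \<phi>(r, s) \<phi>(t, w)\<close> by reassociating twice gives \<open>u\<^sup>2 = 1\<close>. On the other hand,
  evaluating functionals at \<open>1\<close> yields \<open>t(\<phi>(r, s)) = r(u \<phi>(s, t))\<close>, and three such cyclic rotations
  give \<open>u\<^sup>3 = 1\<close>. Hence \<open>u = 1\<close>.
\<close>

section \<open>Tensor products\<close>

locale bimodule_tensor = left: bimodule K R M + right: bimodule K R N
  for K and R :: "('k, 'r, 'a) module_scheme" and M :: "('r, 'm) bimodule"
    and N :: "('r, 'n) bimodule"
begin

section \<open>Pure tensors and their defining relations\<close>

abbreviation F where "F \<equiv> tensor_free M N"
abbreviation H where "H \<equiv> tensor_kernel R M N"
abbreviation T where "T \<equiv> tensor R M N"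
abbreviation elem (infixl "\<boxtimes>" 70) where "x \<boxtimes> y \<equiv> tensor_elem R M N x y"

lemma comm_group_free: "comm_group F"
  by (simp add: tensor_free_def abelian_free_Abelian_group)

sublocale free: comm_group F
  by (rule comm_group_free)

lemma carrier_free: "c \<in> carrier F \<longleftrightarrow> Poly_Mapping.keys c \<subseteq> carrier M \<times> carrier N"
  by (simp add: tensor_free_def)

lemma mult_free: "x \<otimes>\<^bsub>F\<^esub> y = x + y" and one_free: "\<one>\<^bsub>F\<^esub> = 0"
  by (simp_all add: tensor_free_def)

lemma inv_free: "c \<in> carrier F \<Longrightarrow> inv\<^bsub>F\<^esub> c = - c"
  by (simp add: tensor_free_def)

lemma frag_of_carrier [simp]:
  "x \<in> carrier M \<Longrightarrow> y \<in> carrier N \<Longrightarrow> frag_of (x, y) \<in> carrier F"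
  by (simp add: carrier_free)

lemma diff_carrier [intro]: "a \<in> carrier F \<Longrightarrow> b \<in> carrier F \<Longrightarrow> a - b \<in> carrier F"
  by (metis free.m_closed free.inv_closed inv_free mult_free diff_conv_add_uminus)

lemma relations_carrier: "tensor_relations R M N \<subseteq> carrier F"
  unfolding tensor_relations_def
  by (intro Un_least subsetI; elim CollectE exE conjE; hypsubst; intro diff_carrier frag_of_carrier;
      simp add: left.ract_closed right.lact_closed)

lemma subgroup_kernel: "subgroup H F"
  unfolding tensor_kernel_def by (rule free.generate_is_subgroup[OF relations_carrier])

sublocale kernel: normal H F
  by (rule free.subgroup_imp_normal[OF subgroup_kernel])

lemma relation_in_kernel: "c \<in> tensor_relations R M N \<Longrightarrow> c \<in> H"
  unfolding tensor_kernel_def by (rule generate.incl)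

lemma mem_coset_iff: "d \<in> H #>\<^bsub>F\<^esub> c \<longleftrightarrow> (\<exists>h \<in> H. d = h + c)"
  by (simp add: r_coset_def mult_free)

lemma coset_eqI:
  assumes "a \<in> carrier F" "b \<in> carrier F" "a - b \<in> H"
  shows "H #>\<^bsub>F\<^esub> a = H #>\<^bsub>F\<^esub> b"
proof (rule free.repr_independence[symmetric, OF _ assms(2) subgroup_kernel])
  show "a \<in> H #>\<^bsub>F\<^esub> b"
    using assms(3) by (force simp: mem_coset_iff)
qed

lemma carrier_tensor: "carrier T = (\<lambda>c. H #>\<^bsub>F\<^esub> c) ` carrier F"
  by (simp add: tensor_def Let_def carrier_FactGroup)

lemma coset_add:
  "a \<in> carrier F \<Longrightarrow> b \<in> carrier F \<Longrightarrow>
    (H #>\<^bsub>F\<^esub> a) \<oplus>\<^bsub>T\<^esub> (H #>\<^bsub>F\<^esub> b) = H #>\<^bsub>F\<^esub> (a + b)"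
  using kernel.rcos_sum[of a b] by (simp add: tensor_def Let_def mult_free)

lemma tensor_add_closed: "X \<in> carrier T \<Longrightarrow> Y \<in> carrier T \<Longrightarrow> X \<oplus>\<^bsub>T\<^esub> Y \<in> carrier T"
  using free.m_closed by (auto simp: carrier_tensor coset_add mult_free)

lemma elem_closed [simp]: "x \<in> carrier M \<Longrightarrow> y \<in> carrier N \<Longrightarrow> x \<boxtimes> y \<in> carrier T"
  by (auto simp: carrier_tensor tensor_elem_def)

lemma elem_add_left:
  assumes "x \<in> carrier M" "x' \<in> carrier M" "y \<in> carrier N"
  shows "(x \<oplus>\<^bsub>M\<^esub> x') \<boxtimes> y = x \<boxtimes> y \<oplus>\<^bsub>T\<^esub> x' \<boxtimes> y"
proof -
  have "frag_of (x \<oplus>\<^bsub>M\<^esub> x', y) - (frag_of (x, y) + frag_of (x', y)) \<in> H"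
    using assms by (intro relation_in_kernel) (auto simp: tensor_relations_def diff_diff_eq)
  then have "H #>\<^bsub>F\<^esub> frag_of (x \<oplus>\<^bsub>M\<^esub> x', y) = H #>\<^bsub>F\<^esub> (frag_of (x, y) + frag_of (x', y))"
    using assms free.m_closed[of "frag_of (x, y)" "frag_of (x', y)"]
    by (intro coset_eqI) (auto simp: mult_free)
  then show ?thesis
    using assms by (simp add: tensor_elem_def coset_add)
qed

lemma elem_add_right:
  assumes "x \<in> carrier M" "y \<in> carrier N" "y' \<in> carrier N"
  shows "x \<boxtimes> (y \<oplus>\<^bsub>N\<^esub> y') = x \<boxtimes> y \<oplus>\<^bsub>T\<^esub> x \<boxtimes> y'"
proof -
  have "frag_of (x, y \<oplus>\<^bsub>N\<^esub> y') - (frag_of (x, y) + frag_of (x, y')) \<in> H"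
    using assms by (intro relation_in_kernel) (auto simp: tensor_relations_def diff_diff_eq)
  then have "H #>\<^bsub>F\<^esub> frag_of (x, y \<oplus>\<^bsub>N\<^esub> y') = H #>\<^bsub>F\<^esub> (frag_of (x, y) + frag_of (x, y'))"
    using assms free.m_closed[of "frag_of (x, y)" "frag_of (x, y')"]
    by (intro coset_eqI) (auto simp: mult_free)
  then show ?thesis
    using assms by (simp add: tensor_elem_def coset_add)
qed

lemma elem_balanced:
  assumes "x \<in> carrier M" "r \<in> carrier R" "y \<in> carrier N"
  shows "(x \<leftharpoonup>\<^bsub>M\<^esub> r) \<boxtimes> y = x \<boxtimes> (r \<rightharpoonup>\<^bsub>N\<^esub> y)"
  unfolding tensor_elem_def
  using assms by (intro coset_eqI relation_in_kernel)
    (auto simp: tensor_relations_def left.ract_closed right.lact_closed)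

section \<open>Descent of the two actions to the quotient\<close>

lemma frag_extend_closed:
  assumes "\<And>x y. x \<in> carrier M \<Longrightarrow> y \<in> carrier N \<Longrightarrow> e (x, y) \<in> carrier F" "c \<in> carrier F"
  shows "frag_extend e c \<in> carrier F"
proof -
  have "Poly_Mapping.keys (e z) \<subseteq> carrier M \<times> carrier N" if "z \<in> Poly_Mapping.keys c" for z
    using assms that unfolding carrier_free by (cases z) blast
  then show ?thesis
    unfolding carrier_free using keys_frag_extend[of e c] by blast
qed

text \<open>\<open>frag_extend e\<close> is additive, so it maps the generated subgroup into itself
  once it does so for the generators. Induction over \<open>generate\<close> needs inverses of
  generators only.\<close>

lemma frag_extend_kernel:
  assumes "\<And>x y. x \<in> carrier M \<Longrightarrow> y \<in> carrier N \<Longrightarrow> e (x, y) \<in> carrier F"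
    and "\<And>c. c \<in> tensor_relations R M N \<Longrightarrow> frag_extend e c \<in> H" "c \<in> H"
  shows "frag_extend e c \<in> H"
  using assms(3) unfolding tensor_kernel_def
proof (induction rule: generate.induct)
  case one
  then show ?case by (simp add: one_free generate.one[of F, simplified one_free])
next
  case (incl c)
  then show ?case using assms(2) by (simp add: tensor_kernel_def)
next
  case (inv c)
  then have "c \<in> carrier F" using relations_carrier by auto
  moreover have "inv\<^bsub>F\<^esub> (frag_extend e c) \<in> H"
    using assms(2)[OF inv] by (rule subgroup.m_inv_closed[OF subgroup_kernel])
  ultimately show ?case
    using frag_extend_closed[of e c, OF assms(1)]
    by (simp add: inv_free frag_extend_minus tensor_kernel_def)
next
  case (eng a b)
  then show ?case
    using subgroup.m_closed[OF subgroup_kernel]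
    by (simp add: mult_free frag_extend_add tensor_kernel_def)
qed

text \<open>Evaluates the unions by which \<open>tensor\<close> defines its actions: two
  representatives of a coset differ by an element of \<open>H\<close>, and its image is again in
  \<open>H\<close>, so every member of the union is the same coset.\<close>

lemma UN_coset_frag_extend:
  assumes "\<And>x y. x \<in> carrier M \<Longrightarrow> y \<in> carrier N \<Longrightarrow> e (x, y) \<in> carrier F"
    and "\<And>c. c \<in> tensor_relations R M N \<Longrightarrow> frag_extend e c \<in> H" "c \<in> carrier F"
  shows "(\<Union>d \<in> H #>\<^bsub>F\<^esub> c. H #>\<^bsub>F\<^esub> frag_extend e d) = H #>\<^bsub>F\<^esub> frag_extend e c"
proof -
  have eq: "H #>\<^bsub>F\<^esub> frag_extend e d = H #>\<^bsub>F\<^esub> frag_extend e c" if "d \<in> H #>\<^bsub>F\<^esub> c" for d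
  proof -
    from that obtain h where h: "h \<in> H" "d = h + c"
      by (auto simp: mem_coset_iff)
    have h_carrier: "h \<in> carrier F"
      using h(1) by (rule subgroup.mem_carrier[OF subgroup_kernel])
    then have "d \<in> carrier F"
      using h(2) assms(3) free.m_closed[of h c] by (simp add: mult_free)
    moreover have "frag_extend e d - frag_extend e c = frag_extend e h"
      by (simp add: h(2) frag_extend_add)
    moreover have "frag_extend e h \<in> H"
      using assms(1,2) h(1) by (rule frag_extend_kernel)
    moreover have "frag_extend e x \<in> carrier F" if "x \<in> carrier F" for x
      using assms(1) that by (rule frag_extend_closed)
    ultimately show ?thesis
      using assms(3) by (intro coset_eqI) simp_all
  qed
  \<comment> \<open>A union of equal sets is that set only over a nonempty index set.\<close>
  have "c \<in> H #>\<^bsub>F\<^esub> c"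
    using assms(3) by (rule free.rcos_self[OF _ subgroup_kernel])
  then have "H #>\<^bsub>F\<^esub> c \<noteq> {}" by blast
  then show ?thesis
    by (rule SUP_eq_const) (rule eq)
qed

lemma elem_lact:
  assumes r: "r \<in> carrier R" and "x \<in> carrier M" "y \<in> carrier N"
  shows "r \<rightharpoonup>\<^bsub>T\<^esub> (x \<boxtimes> y) = (r \<rightharpoonup>\<^bsub>M\<^esub> x) \<boxtimes> y"
proof -
  let ?e = "\<lambda>(x, y). frag_of (r \<rightharpoonup>\<^bsub>M\<^esub> x, y)"
  have "frag_extend ?e c \<in> H" if "c \<in> tensor_relations R M N" for c
  proof (rule relation_in_kernel)
    \<comment> \<open>Generators even go to generators. Biadditivity relations keep their shape
      because the action is additive; balancedness relations do so because the left and right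
      actions on \<open>M\<close> commute.\<close>
    show "frag_extend ?e c \<in> tensor_relations R M N"
      using that r unfolding tensor_relations_def
      by (elim UnE CollectE exE conjE; simp add: frag_extend_diff left.lact_add_right left.lact_ract[symmetric])
        (blast intro: left.lact_closed)+
  qed
  then show ?thesis
    using assms UN_coset_frag_extend[of ?e "frag_of (x, y)"]
    by (simp add: tensor_def Let_def tensor_elem_def left.lact_closed)
qed

lemma elem_ract:
  assumes r: "r \<in> carrier R" and "x \<in> carrier M" "y \<in> carrier N"
  shows "(x \<boxtimes> y) \<leftharpoonup>\<^bsub>T\<^esub> r = x \<boxtimes> (y \<leftharpoonup>\<^bsub>N\<^esub> r)"
proof -
  let ?e = "\<lambda>(x, y). frag_of (x, y \<leftharpoonup>\<^bsub>N\<^esub> r)"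
  have "frag_extend ?e c \<in> H" if "c \<in> tensor_relations R M N" for c
  proof (rule relation_in_kernel)
    \<comment> \<open>Mirror image of the left action: here the commuting actions are those on
      \<open>N\<close>.\<close>
    show "frag_extend ?e c \<in> tensor_relations R M N"
      using that r unfolding tensor_relations_def
      by (elim UnE CollectE exE conjE; simp add: frag_extend_diff right.ract_add_left right.lact_ract)
        (blast intro: right.ract_closed)+
  qed
  then show ?thesis
    using assms UN_coset_frag_extend[of ?e "frag_of (x, y)"]
    by (simp add: tensor_def Let_def tensor_elem_def right.ract_closed)
qed

section \<open>Universal property of the tensor product\<close>

lemma hom_add_monoid_tensor: "hom (add_monoid T) G = hom (F Mod H) G"
  by (simp add: hom_def tensor_def Let_def)

text \<open>\<open>\<beta>\<close> extends additively to the free group; biadditivity and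
  balancedness say that the extension kills the relations, hence \<open>H\<close>, so it factors
  through the quotient. Uniqueness of the factor is \<open>tensor_hom_eqI\<close>.\<close>

lemma tensor_universal:
  assumes "abelian_group A"
    and closed: "\<And>x y. x \<in> carrier M \<Longrightarrow> y \<in> carrier N \<Longrightarrow> \<beta> x y \<in> carrier A"
    and add_left: "\<And>x x' y. x \<in> carrier M \<Longrightarrow> x' \<in> carrier M \<Longrightarrow> y \<in> carrier N
      \<Longrightarrow> \<beta> (x \<oplus>\<^bsub>M\<^esub> x') y = \<beta> x y \<oplus>\<^bsub>A\<^esub> \<beta> x' y"
    and add_right: "\<And>x y y'. x \<in> carrier M \<Longrightarrow> y \<in> carrier N \<Longrightarrow> y' \<in> carrier N
      \<Longrightarrow> \<beta> x (y \<oplus>\<^bsub>N\<^esub> y') = \<beta> x y \<oplus>\<^bsub>A\<^esub> \<beta> x y'"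
    and balanced: "\<And>x r y. x \<in> carrier M \<Longrightarrow> r \<in> carrier R \<Longrightarrow> y \<in> carrier N
      \<Longrightarrow> \<beta> (x \<leftharpoonup>\<^bsub>M\<^esub> r) y = \<beta> x (r \<rightharpoonup>\<^bsub>N\<^esub> y)"
  shows "\<exists>g \<in> hom (add_monoid T) (add_monoid A).
    \<forall>x \<in> carrier M. \<forall>y \<in> carrier N. g (x \<boxtimes> y) = \<beta> x y"
proof -
  interpret A: abelian_group A by fact
  have "(\<lambda>(x, y). \<beta> x y) ` (carrier M \<times> carrier N) \<subseteq> carrier A"
    using closed by auto
  then have "\<exists>h. h \<in> hom F (add_monoid A) \<and>
      (\<forall>z \<in> carrier M \<times> carrier N. h (frag_of z) = (\<lambda>(x, y). \<beta> x y) z)"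
    unfolding tensor_free_def by (rule A.add.free_Abelian_group_universal) blast
  then obtain h where h_hom: "h \<in> hom F (add_monoid A)"
    and h_pair: "\<And>z. z \<in> carrier M \<times> carrier N \<Longrightarrow> h (frag_of z) = (\<lambda>(x, y). \<beta> x y) z"
    by blast
  have h: "h (frag_of (x, y)) = \<beta> x y" if "x \<in> carrier M" "y \<in> carrier N" for x y
    using h_pair[of "(x, y)"] that by simp
  interpret h: group_hom F "add_monoid A" h
    using h_hom by unfold_locales
  have h_closed: "h c \<in> carrier A" if "c \<in> carrier F" for c
    using h.hom_closed[OF that] by simp
  have h_diff: "h (a - b) = h a \<ominus>\<^bsub>A\<^esub> h b" if "a \<in> carrier F" "b \<in> carrier F" for a b
    using free.inv_closed[of b] h.hom_mult[of a "inv\<^bsub>F\<^esub> b"] h.hom_inv[of b] that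
    by (simp add: mult_free inv_free a_minus_def a_inv_def)
  have h_relation: "h c = \<zero>\<^bsub>A\<^esub>" if "c \<in> tensor_relations R M N" for c
    using that unfolding tensor_relations_def
  proof (elim UnE CollectE exE conjE)
    fix x x' y assume *: "x \<in> carrier M" "x' \<in> carrier M" "y \<in> carrier N"
      "c = frag_of (x \<oplus>\<^bsub>M\<^esub> x', y) - frag_of (x, y) - frag_of (x', y)"
    then show ?thesis
      by (simp add: h_diff h diff_carrier add_left closed A.minus_eq A.add.inv_mult_group A.a_assoc A.a_comm A.a_lcomm A.r_neg A.r_neg1 A.r_neg2)
  next
    fix x y y' assume *: "x \<in> carrier M" "y \<in> carrier N" "y' \<in> carrier N"
      "c = frag_of (x, y \<oplus>\<^bsub>N\<^esub> y') - frag_of (x, y) - frag_of (x, y')"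
    then show ?thesis
      by (simp add: h_diff h diff_carrier add_right closed A.minus_eq A.add.inv_mult_group A.a_assoc A.a_comm A.a_lcomm A.r_neg A.r_neg1 A.r_neg2)
  next
    fix x r y assume "x \<in> carrier M" "r \<in> carrier R" "y \<in> carrier N"
      "c = frag_of (x \<leftharpoonup>\<^bsub>M\<^esub> r, y) - frag_of (x, r \<rightharpoonup>\<^bsub>N\<^esub> y)"
    then show ?thesis
      by (simp add: h_diff h left.ract_closed right.lact_closed balanced closed A.minus_eq A.r_neg)
  qed
  have h_kernel: "h c = \<zero>\<^bsub>A\<^esub>" if "c \<in> H" for c
  proof -
    have "H \<subseteq> kernel F (add_monoid A) h"
      unfolding tensor_kernel_def using h_relation relations_carrier
      by (intro free.generate_subgroup_incl[OF _ h.subgroup_kernel]) (auto simp: kernel_def)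
    then show ?thesis using that by (auto simp: kernel_def)
  qed
  obtain g where g: "g \<in> hom (F Mod H) (add_monoid A)"
    "\<And>c. c \<in> carrier F \<Longrightarrow> g (H #>\<^bsub>F\<^esub> c) = h c"
  proof (rule FactGroup_universal[OF h_hom kernel.normal_axioms])
    fix a b assume ab: "a \<in> carrier F" "b \<in> carrier F" "H #>\<^bsub>F\<^esub> a = H #>\<^bsub>F\<^esub> b"
    then obtain c where "c \<in> H" "b = c + a"
      using free.repr_independenceD[OF subgroup_kernel ab(2,3)] unfolding mem_coset_iff by (elim bexE)
    then show "h a = h b"
      using h.hom_mult[of c a] h_kernel[of c] h_closed ab subgroup.mem_carrier[OF subgroup_kernel]
      by (simp add: mult_free)
  qed blast
  show ?thesis
    using g h by (intro bexI[of _ g]) (auto simp: hom_add_monoid_tensor tensor_elem_def)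
qed

text \<open>Pure tensors generate the group: pulled back to the free group, both maps are
  homomorphisms that agree on the free generators.\<close>

lemma tensor_hom_eqI:
  assumes "abelian_group A" "f \<in> hom (add_monoid T) (add_monoid A)"
    "g \<in> hom (add_monoid T) (add_monoid A)"
    and eq: "\<And>x y. x \<in> carrier M \<Longrightarrow> y \<in> carrier N \<Longrightarrow> f (x \<boxtimes> y) = g (x \<boxtimes> y)"
    and "X \<in> carrier T"
  shows "f X = g X"
proof -
  interpret A: abelian_group A by fact
  have "(\<lambda>c. k (H #>\<^bsub>F\<^esub> c)) \<in> hom F (add_monoid A)" if "k \<in> hom (add_monoid T) (add_monoid A)" for k
    using that by (auto simp: hom_def Pi_iff carrier_tensor coset_add mult_free)
  then interpret f: group_hom F "add_monoid A" "\<lambda>c. f (H #>\<^bsub>F\<^esub> c)"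
    + g: group_hom F "add_monoid A" "\<lambda>c. g (H #>\<^bsub>F\<^esub> c)"
    using assms(2,3) by unfold_locales auto
  obtain c where c: "c \<in> carrier F" "X = H #>\<^bsub>F\<^esub> c"
    using assms(5) by (auto simp: carrier_tensor)
  have "Poly_Mapping.keys c \<subseteq> carrier M \<times> carrier N"
    using c by (simp add: carrier_free)
  \<comment> \<open>Membership in the carrier is carried along because the homomorphism laws in the
    difference case hold only there.\<close>
  then have "c \<in> carrier F \<and> f (H #>\<^bsub>F\<^esub> c) = g (H #>\<^bsub>F\<^esub> c)"
  proof (induction rule: frag_induction)
    case zero
    then show ?case
      using f.hom_one g.hom_one free.one_closed by (simp add: one_free)
  next
    case (one z)
    then show ?case
      using eq by (auto simp: tensor_elem_def)
  next
    case (diff a b)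
    then show ?case
      using free.inv_closed[of b] diff_carrier[of a b] f.hom_mult[of a "inv\<^bsub>F\<^esub> b"] f.hom_inv[of b] g.hom_mult[of a "inv\<^bsub>F\<^esub> b"] g.hom_inv[of b]
      by (auto simp: mult_free inv_free)
  qed
  then show ?thesis
    using c by simp
qed

end

section \<open>The dual bimodule\<close>

text \<open>Over an infinite index set both sums are zero by convention, and \<open>h\<close>
  preserves zero; finite sets go by induction.\<close>

lemma hom_finsum:
  assumes "abelian_group M" "abelian_group N" "h \<in> hom (add_monoid M) (add_monoid N)"
    "f \<in> A \<rightarrow> carrier M"
  shows "h (finsum M f A) = finsum N (\<lambda>x. h (f x)) A"
proof -
  interpret M: abelian_group M by fact
  interpret N: abelian_group N by fact
  interpret h: group_hom "add_monoid M" "add_monoid N" h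
    using assms(3) by unfold_locales
  have "h x \<in> carrier N" if "x \<in> carrier M" for x
    using h.hom_closed that by simp
  then show ?thesis
    using assms(4) h.hom_one h.hom_mult
    by (induction A rule: infinite_finite_induct) (simp_all add: Pi_iff)
qed

context unital_algebra
begin

abbreviation D where "D \<equiv> dual_bimodule K R"

lemma dual_closed: "f \<in> carrier D \<Longrightarrow> x \<in> carrier R \<Longrightarrow> f x \<in> carrier K"
  by (auto simp: dual_bimodule_def)

lemma dual_add:
  "f \<in> carrier D \<Longrightarrow> x \<in> carrier R \<Longrightarrow> y \<in> carrier R \<Longrightarrow> f (x \<oplus> y) = f x \<oplus>\<^bsub>K\<^esub> f y"
  by (auto simp: dual_bimodule_def)

lemma dual_smult:
  "f \<in> carrier D \<Longrightarrow> c \<in> carrier K \<Longrightarrow> x \<in> carrier R \<Longrightarrow> f (c \<odot> x) = c \<otimes>\<^bsub>K\<^esub> f x"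
  by (auto simp: dual_bimodule_def)

lemma dual_eqI:
  "f \<in> carrier D \<Longrightarrow> g \<in> carrier D \<Longrightarrow> (\<And>x. x \<in> carrier R \<Longrightarrow> f x = g x) \<Longrightarrow> f = g"
  by (auto simp: dual_bimodule_def intro: PiE_ext)

lemma dual_memI:
  assumes "\<And>x. x \<in> carrier R \<Longrightarrow> f x \<in> carrier K"
    "\<And>x y. x \<in> carrier R \<Longrightarrow> y \<in> carrier R \<Longrightarrow> f (x \<oplus> y) = f x \<oplus>\<^bsub>K\<^esub> f y"
    "\<And>c x. c \<in> carrier K \<Longrightarrow> x \<in> carrier R \<Longrightarrow> f (c \<odot> x) = c \<otimes>\<^bsub>K\<^esub> f x"
  shows "restrict f (carrier R) \<in> carrier D"
  using assms by (auto simp: dual_bimodule_def)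

lemma dual_simps:
  assumes "x \<in> carrier R"
  shows dual_zero_apply: "\<zero>\<^bsub>D\<^esub> x = \<zero>\<^bsub>K\<^esub>"
    and dual_add_apply: "(f \<oplus>\<^bsub>D\<^esub> g) x = f x \<oplus>\<^bsub>K\<^esub> g x"
    and dual_lact_apply: "(r \<rightharpoonup>\<^bsub>D\<^esub> f) x = f (x \<otimes> r)"
    and dual_ract_apply: "(f \<leftharpoonup>\<^bsub>D\<^esub> r) x = f (r \<otimes> x)"
  using assms by (simp_all add: dual_bimodule_def)

lemma dual_zero_closed: "\<zero>\<^bsub>D\<^esub> \<in> carrier D"
proof -
  have "restrict (\<lambda>x. \<zero>\<^bsub>K\<^esub>) (carrier R) \<in> carrier D"
    by (rule dual_memI) simp_all
  then show ?thesis by (simp add: dual_bimodule_def)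
qed

lemma dual_add_closed:
  assumes "f \<in> carrier D" "g \<in> carrier D"
  shows "f \<oplus>\<^bsub>D\<^esub> g \<in> carrier D"
proof -
  have "restrict (\<lambda>x. f x \<oplus>\<^bsub>K\<^esub> g x) (carrier R) \<in> carrier D"
    using assms
    by (intro dual_memI) (simp_all add: dual_closed dual_add dual_smult module.R.r_distr module.R.a_ac)
  then show ?thesis by (simp add: dual_bimodule_def)
qed

lemma dual_lact_closed:
  assumes "f \<in> carrier D" "r \<in> carrier R"
  shows "r \<rightharpoonup>\<^bsub>D\<^esub> f \<in> carrier D"
proof -
  have "restrict (\<lambda>x. f (x \<otimes> r)) (carrier R) \<in> carrier D"
    using assms
    by (intro dual_memI) (simp_all add: dual_closed dual_add dual_smult smult_mult_left l_distr)
  then show ?thesis by (simp add: dual_bimodule_def)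
qed

lemma dual_ract_closed:
  assumes "f \<in> carrier D" "r \<in> carrier R"
  shows "f \<leftharpoonup>\<^bsub>D\<^esub> r \<in> carrier D"
proof -
  have "restrict (\<lambda>x. f (r \<otimes> x)) (carrier R) \<in> carrier D"
    using assms
    by (intro dual_memI) (simp_all add: dual_closed dual_add dual_smult smult_mult_right r_distr)
  then show ?thesis by (simp add: dual_bimodule_def)
qed

lemma abelian_group_dual: "abelian_group D"
proof (rule abelian_groupI)
  fix f assume f: "f \<in> carrier D"
  let ?g = "\<lambda>x \<in> carrier R. \<ominus>\<^bsub>K\<^esub> f x"
  have "?g \<in> carrier D"
    using f by (intro dual_memI) (simp_all add: dual_closed dual_add dual_smult module.R.minus_add module.R.r_minus)
  moreover from this have "?g \<oplus>\<^bsub>D\<^esub> f = \<zero>\<^bsub>D\<^esub>"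
    using f by (intro dual_eqI) (simp_all add: dual_add_closed dual_zero_closed dual_simps dual_closed module.R.l_neg)
  ultimately show "\<exists>g \<in> carrier D. g \<oplus>\<^bsub>D\<^esub> f = \<zero>\<^bsub>D\<^esub>" by blast
qed (auto intro!: dual_eqI simp: dual_add_closed dual_zero_closed dual_simps dual_closed module.R.a_ac)

section \<open>Evaluation, dual bases and biduality\<close>

lemma dual_apply_hom:
  "x \<in> carrier R \<Longrightarrow> (\<lambda>f. f x) \<in> hom (add_monoid D) (add_monoid K)"
  by (auto simp: hom_def dual_closed dual_simps)

text \<open>The bimodule record has no scalar multiplication; acting by
  \<open>c \<odot> \<one>\<close> recovers pointwise scaling, which lets linearity on the dual be
  expressed by the left action.\<close>

lemma dual_scalar_apply:
  "f \<in> carrier D \<Longrightarrow> c \<in> carrier K \<Longrightarrow> x \<in> carrier R \<Longrightarrow>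
    ((c \<odot> \<one>) \<rightharpoonup>\<^bsub>D\<^esub> f) x = c \<otimes>\<^bsub>K\<^esub> f x"
  by (simp add: dual_simps smult_mult_right dual_smult)

text \<open>The functionals are the coordinates with respect to a basis; uniqueness of coordinates
  makes them linear.\<close>

lemma finite_dual_basis:
  assumes "fin_dim"
  obtains B b where "finite B" "B \<subseteq> carrier R" "b \<in> B \<rightarrow> carrier D"
    "\<And>x. x \<in> carrier R \<Longrightarrow> x = lincomb (\<lambda>v. b v x) B"
proof -
  obtain B where B: "finite B" "basis B"
    using finite_basis_exists[OF assms] by blast
  then have B_carrier: "B \<subseteq> carrier R" by (simp add: basis_def)
  have ex1: "\<exists>!a. a \<in> B \<rightarrow>\<^sub>E carrier K \<and> lincomb a B = x" if "x \<in> carrier R" for x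
    using basis_criterion[OF B(1) B_carrier] B(2) that by blast
  \<comment> \<open>Coordinate families are taken extensional on \<open>B\<close>, since only then
    is the family unique as a function.\<close>
  define a where "a x = (THE a. a \<in> B \<rightarrow>\<^sub>E carrier K \<and> lincomb a B = x)" for x
  have a: "a x \<in> B \<rightarrow>\<^sub>E carrier K" "lincomb (a x) B = x" if "x \<in> carrier R" for x
    using theI'[OF ex1[OF that]] unfolding a_def by blast+
  have a_closed: "a x v \<in> carrier K" if "x \<in> carrier R" "v \<in> B" for x v
    using a(1)[OF that(1)] that(2) by blast
  \<comment> \<open>Any family representing \<open>x\<close> agrees with \<open>a x\<close> on
    \<open>B\<close>. Below, this is applied to the pointwise sum and the pointwise multiple of
    coordinate families.\<close>
  have a_unique: "a x v = a' v" if "a' \<in> B \<rightarrow> carrier K" "lincomb a' B = x" "v \<in> B" for x a' v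
  proof -
    have "lincomb (restrict a' B) B = x"
      using that B_carrier by (auto intro!: lincomb_cong)
    moreover have "x \<in> carrier R"
      using that B_carrier by auto
    moreover have "restrict a' B \<in> B \<rightarrow>\<^sub>E carrier K"
      using that(1) by auto
    ultimately have "a x = restrict a' B"
      unfolding a_def by (intro the1_equality ex1) simp_all
    then show ?thesis using that by simp
  qed
  show thesis
  proof (rule that[OF B(1) B_carrier, of "\<lambda>v. \<lambda>x \<in> carrier R. a x v"])
    show "(\<lambda>v. \<lambda>x \<in> carrier R. a x v) \<in> B \<rightarrow> carrier D"
    proof
      fix v assume v: "v \<in> B"
      show "(\<lambda>x \<in> carrier R. a x v) \<in> carrier D"
      proof (rule dual_memI)
        show "a (x \<oplus> y) v = a x v \<oplus>\<^bsub>K\<^esub> a y v" if "x \<in> carrier R" "y \<in> carrier R" for x y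
        proof (rule a_unique[OF _ _ v])
          show "lincomb (\<lambda>v. a x v \<oplus>\<^bsub>K\<^esub> a y v) B = x \<oplus> y"
            using that a_closed a(2) by (subst lincomb_sum[OF B(1) B_carrier]) auto
        qed (use that a_closed in auto)
        show "a (c \<odot> x) v = c \<otimes>\<^bsub>K\<^esub> a x v" if "c \<in> carrier K" "x \<in> carrier R" for c x
        proof (rule a_unique[OF _ _ v])
          show "lincomb (\<lambda>v. c \<otimes>\<^bsub>K\<^esub> a x v) B = c \<odot> x"
            using that a_closed a(2) by (subst lincomb_smult[OF B_carrier]) auto
        qed (use that a_closed in auto)
      qed (use a_closed v in blast)
    qed
    show "x = lincomb (\<lambda>v. (\<lambda>x \<in> carrier R. a x v) x) B" if "x \<in> carrier R" for x
      using that a by simp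
  qed
qed

lemma dual_separates:
  assumes "fin_dim" "x \<in> carrier R" "y \<in> carrier R" "\<And>f. f \<in> carrier D \<Longrightarrow> f x = f y"
  shows "x = y"
proof -
  obtain B b where B: "finite B" "B \<subseteq> carrier R" "b \<in> B \<rightarrow> carrier D"
    "\<And>x. x \<in> carrier R \<Longrightarrow> x = lincomb (\<lambda>v. b v x) B"
    by (rule finite_dual_basis[OF assms(1)]) blast
  have "lincomb (\<lambda>v. b v x) B = lincomb (\<lambda>v. b v y) B"
    using assms B(2,3) by (intro lincomb_cong) (auto simp: dual_closed Pi_iff)
  then show ?thesis
    using B(4) assms(2,3) by metis
qed

lemma dual_apply_lincomb:
  assumes "f \<in> carrier D" "finite B" "B \<subseteq> carrier R" "a \<in> B \<rightarrow> carrier K"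
  shows "f (lincomb a B) = (\<Oplus>\<^bsub>K\<^esub>v \<in> B. a v \<otimes>\<^bsub>K\<^esub> f v)"
proof -
  have "f \<in> hom (add_monoid R) (add_monoid K)"
    using assms(1) by (auto simp: hom_def dual_closed dual_add)
  then have "f (lincomb a B) = (\<Oplus>\<^bsub>K\<^esub>v \<in> B. f (a v \<odot> v))"
    unfolding lincomb_def using assms
    by (intro hom_finsum module.M.abelian_group_axioms module.R.abelian_group_axioms) auto
  also have "\<dots> = (\<Oplus>\<^bsub>K\<^esub>v \<in> B. a v \<otimes>\<^bsub>K\<^esub> f v)"
    using assms by (intro module.R.finsum_cong') (auto simp: dual_smult dual_closed Pi_iff subset_iff)
  finally show ?thesis .
qed

text \<open>Surjectivity of the canonical map from \<open>R\<close> to its bidual. Applying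
  \<open>L\<close> to the expansion of \<open>f\<close> in the dual basis, with coefficients
  \<open>f v\<close>, gives the value of \<open>f\<close> at the combination of the \<open>v\<close>
  with coefficients \<open>L (b v)\<close>.\<close>

lemma bidual_eval:
  assumes "fin_dim"
    and hom: "L \<in> hom (add_monoid D) (add_monoid K)"
    and scalar: "\<And>c f. c \<in> carrier K \<Longrightarrow> f \<in> carrier D \<Longrightarrow> L ((c \<odot> \<one>) \<rightharpoonup>\<^bsub>D\<^esub> f) = c \<otimes>\<^bsub>K\<^esub> L f"
  obtains u where "u \<in> carrier R" "\<And>f. f \<in> carrier D \<Longrightarrow> L f = f u"
proof -
  interpret D: abelian_group D by (rule abelian_group_dual)
  obtain B b where B: "finite B" "B \<subseteq> carrier R" "b \<in> B \<rightarrow> carrier D"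
    "\<And>x. x \<in> carrier R \<Longrightarrow> x = lincomb (\<lambda>v. b v x) B"
    by (rule finite_dual_basis[OF assms(1)]) blast
  have L_closed: "L f \<in> carrier K" if "f \<in> carrier D" for f
    using hom that by (auto simp: hom_def)
  define u where "u = lincomb (\<lambda>v. L (b v)) B"
  have u: "u \<in> carrier R"
    unfolding u_def using B by (auto intro!: lincomb_closed L_closed)
  have "L f = f u" if f: "f \<in> carrier D" for f
  proof -
    let ?g = "\<lambda>v. (f v \<odot> \<one>) \<rightharpoonup>\<^bsub>D\<^esub> b v"
    have fv: "f v \<in> carrier K" if "v \<in> B" for v
      using f B that by (auto simp: dual_closed)
    have bv: "b v \<in> carrier D" if "v \<in> B" for v
      using B that by auto
    have g: "?g \<in> B \<rightarrow> carrier D"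
      using fv bv by (auto intro!: dual_lact_closed)
    \<comment> \<open>At \<open>x\<close> the sum is that of the \<open>b v x\<close> times
      \<open>f v\<close>, which is \<open>f\<close> applied to the basis expansion of
      \<open>x\<close>.\<close>
    have "f = finsum D ?g B"
    proof (rule dual_eqI[OF f])
      fix x assume x: "x \<in> carrier R"
      have "finsum D ?g B x = (\<Oplus>\<^bsub>K\<^esub>v \<in> B. ?g v x)"
        using dual_apply_hom[OF x] g
        by (rule hom_finsum[OF abelian_group_dual module.R.abelian_group_axioms])
      also have "\<dots> = (\<Oplus>\<^bsub>K\<^esub>v \<in> B. b v x \<otimes>\<^bsub>K\<^esub> f v)"
        using fv bv x by (intro module.R.finsum_cong') (auto simp: dual_scalar_apply dual_closed module.R.m_comm)
      also have "\<dots> = f (lincomb (\<lambda>v. b v x) B)"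
        using f B x bv by (intro dual_apply_lincomb[symmetric]) (auto simp: dual_closed)
      finally show "f x = finsum D ?g B x"
        using B(4)[OF x] by simp
    qed (use g in auto)
    then have "L f = L (finsum D ?g B)"
      by simp
    also have "\<dots> = (\<Oplus>\<^bsub>K\<^esub>v \<in> B. L (?g v))"
      using hom g by (rule hom_finsum[OF abelian_group_dual module.R.abelian_group_axioms])
    also have "\<dots> = (\<Oplus>\<^bsub>K\<^esub>v \<in> B. L (b v) \<otimes>\<^bsub>K\<^esub> f v)"
      using fv bv L_closed by (intro module.R.finsum_cong') (auto simp: scalar module.R.m_comm)
    also have "\<dots> = f u"
      unfolding u_def using f B bv L_closed by (intro dual_apply_lincomb[symmetric]) auto
    finally show ?thesis .
  qed
  with u show thesis by (rule that)
qed

end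

text \<open>By biduality, \<open>\<theta> f \<one>\<close> is the value of \<open>f\<close> at some
  \<open>u\<close>. Left linearity then gives \<open>\<theta> f x = f (u \<otimes> x)\<close> and
  right linearity \<open>\<theta> f x = f (x \<otimes> u)\<close>; as functionals separate points,
  \<open>u\<close> is central.\<close>

lemma (in unital_algebra) dual_endomorphism_central:
  assumes fin: "fin_dim" and \<theta>: "\<theta> \<in> bimodule_hom R D D"
  obtains u where "u \<in> carrier R" "\<And>x. x \<in> carrier R \<Longrightarrow> x \<otimes> u = u \<otimes> x"
    "\<And>f. f \<in> carrier D \<Longrightarrow> \<theta> f = u \<rightharpoonup>\<^bsub>D\<^esub> f"
proof -
  have closed: "\<theta> f \<in> carrier D" if "f \<in> carrier D" for f
    using \<theta> that by (auto simp: bimodule_hom_def)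
  have add: "\<theta> (f \<oplus>\<^bsub>D\<^esub> g) = \<theta> f \<oplus>\<^bsub>D\<^esub> \<theta> g" if "f \<in> carrier D" "g \<in> carrier D" for f g
    using \<theta> that by (auto simp: bimodule_hom_def)
  have lact: "\<theta> (r \<rightharpoonup>\<^bsub>D\<^esub> f) = r \<rightharpoonup>\<^bsub>D\<^esub> \<theta> f" if "r \<in> carrier R" "f \<in> carrier D" for r f
    using \<theta> that by (auto simp: bimodule_hom_def)
  have ract: "\<theta> (f \<leftharpoonup>\<^bsub>D\<^esub> r) = \<theta> f \<leftharpoonup>\<^bsub>D\<^esub> r" if "r \<in> carrier R" "f \<in> carrier D" for r f
    using \<theta> that by (auto simp: bimodule_hom_def)
  obtain u where u: "u \<in> carrier R" and eval: "\<And>f. f \<in> carrier D \<Longrightarrow> \<theta> f \<one> = f u"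
  proof (rule bidual_eval[OF fin, of "\<lambda>f. \<theta> f \<one>"])
    show "(\<lambda>f. \<theta> f \<one>) \<in> hom (add_monoid D) (add_monoid K)"
      by (simp add: hom_def closed add dual_closed dual_add_apply)
    show "\<theta> ((c \<odot> \<one>) \<rightharpoonup>\<^bsub>D\<^esub> f) \<one> = c \<otimes>\<^bsub>K\<^esub> \<theta> f \<one>" if "c \<in> carrier K" "f \<in> carrier D" for c f
      using that by (simp add: lact closed dual_scalar_apply)
  qed blast
  have left: "\<theta> f x = f (u \<otimes> x)" if "f \<in> carrier D" "x \<in> carrier R" for f x
    using eval[OF dual_lact_closed[OF that]] that u
    by (simp add: lact dual_lact_apply)
  have right: "\<theta> f x = f (x \<otimes> u)" if "f \<in> carrier D" "x \<in> carrier R" for f x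
    using eval[OF dual_ract_closed[OF that]] that u
    by (simp add: ract dual_ract_apply)
  show thesis
  proof (rule that[OF u])
    show "x \<otimes> u = u \<otimes> x" if "x \<in> carrier R" for x
    proof (rule dual_separates[OF fin])
      show "f (x \<otimes> u) = f (u \<otimes> x)" if "f \<in> carrier D" for f
        using left[OF that \<open>x \<in> carrier R\<close>] right[OF that \<open>x \<in> carrier R\<close>] by simp
    qed (use that u in auto)
    show "\<theta> f = u \<rightharpoonup>\<^bsub>D\<^esub> f" if "f \<in> carrier D" for f
      using that u by (intro dual_eqI) (simp_all add: closed dual_lact_closed dual_lact_apply right)
  qed
qed

section \<open>Isomorphisms from the tensor square of the dual\<close>

locale dual_square =
  bimodule_tensor K R "dual_bimodule K R" "dual_bimodule K R"
  for K and R :: "('k, 'r, 'a) module_scheme" (structure) +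
  fixes \<psi> :: "(('r \<Rightarrow> 'k) \<times> ('r \<Rightarrow> 'k) \<Rightarrow>\<^sub>0 int) set \<Rightarrow> 'r"
  assumes fin_dim: "left.fin_dim"
    and iso: "\<psi> \<in> bimodule_iso R
      (tensor R (dual_bimodule K R) (dual_bimodule K R)) (regular_bimodule R)"
begin

abbreviation D where "D \<equiv> dual_bimodule K R"
abbreviation dual_lact (infixr "\<triangleright>" 70) where "r \<triangleright> f \<equiv> r \<rightharpoonup>\<^bsub>D\<^esub> f"
abbreviation dual_ract (infixl "\<triangleleft>" 70) where "f \<triangleleft> r \<equiv> f \<leftharpoonup>\<^bsub>D\<^esub> r"
abbreviation tens (infixl "\<boxtimes>" 70) where "f \<boxtimes> g \<equiv> tensor_elem R D D f g"
abbreviation \<phi> where "\<phi> f g \<equiv> \<psi> (f \<boxtimes> g)"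

section \<open>The balanced pairing induced by the isomorphism\<close>

lemma psi_bij: "bij_betw \<psi> (carrier T) (carrier R)"
  using iso by (simp add: bimodule_iso_def regular_bimodule_def)

lemma psi_closed: "X \<in> carrier T \<Longrightarrow> \<psi> X \<in> carrier R"
  using psi_bij by (auto simp: bij_betw_def)

lemma psi_add: "X \<in> carrier T \<Longrightarrow> Y \<in> carrier T \<Longrightarrow> \<psi> (X \<oplus>\<^bsub>T\<^esub> Y) = \<psi> X \<oplus> \<psi> Y"
  using iso by (simp add: bimodule_iso_def bimodule_hom_def regular_bimodule_def)

lemma phi_closed: "f \<in> carrier D \<Longrightarrow> g \<in> carrier D \<Longrightarrow> \<phi> f g \<in> carrier R"
  by (simp add: psi_closed)

lemma phi_add_left:
  "f \<in> carrier D \<Longrightarrow> f' \<in> carrier D \<Longrightarrow> g \<in> carrier D \<Longrightarrow> \<phi> (f \<oplus>\<^bsub>D\<^esub> f') g = \<phi> f g \<oplus> \<phi> f' g"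
  by (simp add: elem_add_left psi_add)

lemma phi_add_right:
  "f \<in> carrier D \<Longrightarrow> g \<in> carrier D \<Longrightarrow> g' \<in> carrier D \<Longrightarrow> \<phi> f (g \<oplus>\<^bsub>D\<^esub> g') = \<phi> f g \<oplus> \<phi> f g'"
  by (simp add: elem_add_right psi_add)

lemma phi_balanced:
  "f \<in> carrier D \<Longrightarrow> r \<in> carrier R \<Longrightarrow> g \<in> carrier D \<Longrightarrow> \<phi> (f \<triangleleft> r) g = \<phi> f (r \<triangleright> g)"
  by (simp add: elem_balanced)

lemma phi_lact:
  assumes "r \<in> carrier R" "f \<in> carrier D" "g \<in> carrier D"
  shows "\<phi> (r \<triangleright> f) g = r \<otimes> \<phi> f g"
proof -
  have "\<psi> (r \<rightharpoonup>\<^bsub>T\<^esub> (f \<boxtimes> g)) = r \<otimes> \<phi> f g"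
    using iso assms by (simp add: bimodule_iso_def bimodule_hom_def regular_bimodule_def)
  then show ?thesis using assms by (simp add: elem_lact)
qed

lemma phi_ract:
  assumes "r \<in> carrier R" "f \<in> carrier D" "g \<in> carrier D"
  shows "\<phi> f (g \<triangleleft> r) = \<phi> f g \<otimes> r"
proof -
  have "\<psi> ((f \<boxtimes> g) \<leftharpoonup>\<^bsub>T\<^esub> r) = \<phi> f g \<otimes> r"
    using iso assms by (simp add: bimodule_iso_def bimodule_hom_def regular_bimodule_def)
  then show ?thesis using assms by (simp add: elem_ract)
qed

text \<open>The values of \<open>\<phi>\<close> generate \<open>R\<close> additively, since
  \<open>\<psi>\<close> is onto and pure tensors generate its domain. Additive identities in
  \<open>R\<close> can thus be checked on these values.\<close>

lemma phi_hom_eqI: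
  assumes "abelian_group A" "h \<in> hom (add_monoid R) (add_monoid A)"
    "h' \<in> hom (add_monoid R) (add_monoid A)"
    and "\<And>f g. f \<in> carrier D \<Longrightarrow> g \<in> carrier D \<Longrightarrow> h (\<phi> f g) = h' (\<phi> f g)"
    and "a \<in> carrier R"
  shows "h a = h' a"
proof -
  have comp: "(\<lambda>X. k (\<psi> X)) \<in> hom (add_monoid T) (add_monoid A)"
    if "k \<in> hom (add_monoid R) (add_monoid A)" for k
  proof (rule homI)
    show "k (\<psi> X) \<in> carrier (add_monoid A)" if "X \<in> carrier (add_monoid T)" for X
      using hom_in_carrier[OF \<open>k \<in> _\<close>, of "\<psi> X"] that by (simp add: psi_closed)
    show "k (\<psi> (X \<otimes>\<^bsub>add_monoid T\<^esub> Y)) = k (\<psi> X) \<otimes>\<^bsub>add_monoid A\<^esub> k (\<psi> Y)"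
      if "X \<in> carrier (add_monoid T)" "Y \<in> carrier (add_monoid T)" for X Y
      using hom_mult[OF \<open>k \<in> _\<close>, of "\<psi> X" "\<psi> Y"] that by (simp add: psi_closed psi_add)
  qed
  have "a \<in> \<psi> ` carrier T"
    using psi_bij assms(5) by (simp add: bij_betw_def)
  then obtain X where X: "X \<in> carrier T" "a = \<psi> X"
    by blast
  show ?thesis
    unfolding X(2)
    by (rule tensor_hom_eqI[OF assms(1) comp[OF assms(2)] comp[OF assms(3)] assms(4) X(1)])
qed

text \<open>Through the bijection \<open>\<psi>\<close>, the ring \<open>R\<close> with the pairing
  \<open>\<phi>\<close> is itself a tensor square of \<open>D\<close>, so later constructions can
  avoid cosets.\<close>

lemma phi_universal:
  assumes "abelian_group A"
    and "\<And>f g. f \<in> carrier D \<Longrightarrow> g \<in> carrier D \<Longrightarrow> \<beta> f g \<in> carrier A"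
    and "\<And>f f' g. f \<in> carrier D \<Longrightarrow> f' \<in> carrier D \<Longrightarrow> g \<in> carrier D
      \<Longrightarrow> \<beta> (f \<oplus>\<^bsub>D\<^esub> f') g = \<beta> f g \<oplus>\<^bsub>A\<^esub> \<beta> f' g"
    and "\<And>f g g'. f \<in> carrier D \<Longrightarrow> g \<in> carrier D \<Longrightarrow> g' \<in> carrier D
      \<Longrightarrow> \<beta> f (g \<oplus>\<^bsub>D\<^esub> g') = \<beta> f g \<oplus>\<^bsub>A\<^esub> \<beta> f g'"
    and "\<And>f r g. f \<in> carrier D \<Longrightarrow> r \<in> carrier R \<Longrightarrow> g \<in> carrier D
      \<Longrightarrow> \<beta> (f \<triangleleft> r) g = \<beta> f (r \<triangleright> g)"
  shows "\<exists>h \<in> hom (add_monoid R) (add_monoid A).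
    \<forall>f \<in> carrier D. \<forall>g \<in> carrier D. h (\<phi> f g) = \<beta> f g"
proof -
  have "\<exists>k \<in> hom (add_monoid T) (add_monoid A).
      \<forall>f \<in> carrier D. \<forall>g \<in> carrier D. k (f \<boxtimes> g) = \<beta> f g"
    by (rule tensor_universal[OF assms])
  then obtain k where k: "k \<in> hom (add_monoid T) (add_monoid A)"
    "\<And>f g. f \<in> carrier D \<Longrightarrow> g \<in> carrier D \<Longrightarrow> k (f \<boxtimes> g) = \<beta> f g"
    by blast
  define \<psi>' where "\<psi>' = inv_into (carrier T) \<psi>"
  have inv: "\<psi>' (\<psi> X) = X" if "X \<in> carrier T" for X
    using psi_bij that by (simp add: \<psi>'_def bij_betw_def)
  have \<psi>'_closed: "\<psi>' a \<in> carrier T" and \<psi>'_right: "\<psi> (\<psi>' a) = a" if "a \<in> carrier R" for a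
    using psi_bij that by (auto simp: \<psi>'_def bij_betw_def inv_into_into f_inv_into_f)
  have \<psi>'_add: "\<psi>' (a \<oplus> b) = \<psi>' a \<oplus>\<^bsub>T\<^esub> \<psi>' b" if "a \<in> carrier R" "b \<in> carrier R" for a b
    using inv[of "\<psi>' a \<oplus>\<^bsub>T\<^esub> \<psi>' b"] that by (simp add: tensor_add_closed \<psi>'_closed \<psi>'_right psi_add)
  show ?thesis
  proof (intro bexI[of _ "\<lambda>a. k (\<psi>' a)"] ballI)
    show "(\<lambda>a. k (\<psi>' a)) \<in> hom (add_monoid R) (add_monoid A)"
      using k(1) by (simp add: hom_def \<psi>'_closed \<psi>'_add Pi_iff)
  qed (simp add: inv k(2))
qed

section \<open>The associator and its central element\<close>

text \<open>The endomorphism is \<open>r \<mapsto> \<Sum>\<^sub>i \<phi>(r, s\<^sub>i) t\<^sub>i\<close>, where \<open>\<Sum>\<^sub>i s\<^sub>i \<otimes> t\<^sub>i = \<psi>\<^sup>-\<^sup>1(1)\<close>. To avoid the sum,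
  the map \<open>s \<otimes> t \<mapsto> \<phi>(r, s) t\<close> is transported along \<open>\<psi>\<close> to \<open>h r : R \<rightarrow> D\<close> and evaluated at \<open>1\<close>.\<close>

lemma associator_endomorphism:
  obtains \<theta> where "\<theta> \<in> bimodule_hom R D D"
    "\<And>r s t. r \<in> carrier D \<Longrightarrow> s \<in> carrier D \<Longrightarrow> t \<in> carrier D \<Longrightarrow> \<phi> r s \<triangleright> t = \<theta> (r \<triangleleft> \<phi> s t)"
proof -
  note cl = left.lact_closed left.ract_closed phi_closed left.M.a_closed
  have "\<exists>h \<in> hom (add_monoid R) (add_monoid D).
      \<forall>s \<in> carrier D. \<forall>t \<in> carrier D. h (\<phi> s t) = \<phi> r s \<triangleright> t"
    if r: "r \<in> carrier D" for r
    by (rule phi_universal)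
      (simp_all add: r cl left.M.abelian_group_axioms phi_add_right left.lact_add_left
        left.lact_add_right phi_ract left.lact_mult)
  then obtain h where h_hom: "\<And>r. r \<in> carrier D \<Longrightarrow> h r \<in> hom (add_monoid R) (add_monoid D)"
    and h_phi: "\<And>r s t. r \<in> carrier D \<Longrightarrow> s \<in> carrier D \<Longrightarrow> t \<in> carrier D \<Longrightarrow> h r (\<phi> s t) = \<phi> r s \<triangleright> t"
    by metis
  have h_closed: "h r a \<in> carrier D" if "r \<in> carrier D" "a \<in> carrier R" for r a
    using h_hom[OF that(1)] that(2) by (auto simp: hom_def)
  have h_add: "h r (a \<oplus> b) = h r a \<oplus>\<^bsub>D\<^esub> h r b"
    if "r \<in> carrier D" "a \<in> carrier R" "b \<in> carrier R" for r a b
    using h_hom[OF that(1)] that(2,3) by (auto simp: hom_def)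
  note eqI = phi_hom_eqI[OF left.M.abelian_group_axioms]
  \<comment> \<open>In this and the next three identities both sides are additive in
    \<open>a\<close>, so \<open>a = \<phi> s t\<close> suffices, where \<open>h_phi\<close> and the
    bilinearity of \<open>\<phi>\<close> apply.\<close>
  have h_ract: "h r a \<triangleleft> b = h r (a \<otimes> b)"
    if "r \<in> carrier D" "a \<in> carrier R" "b \<in> carrier R" for r a b
    using that(2)
    by (rule eqI[where h = "\<lambda>a. h r a \<triangleleft> b" and h' = "\<lambda>a. h r (a \<otimes> b)", rotated 3])
      (simp_all add: hom_def that cl h_closed h_add left.ract_add_left left.l_distr h_phi
        phi_ract[symmetric] left.lact_ract)
  have h_balanced: "h (r \<triangleleft> b) a = h r (b \<otimes> a)"
    if "r \<in> carrier D" "a \<in> carrier R" "b \<in> carrier R" for r a b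
    using that(2)
    by (rule eqI[where h = "h (r \<triangleleft> b)" and h' = "\<lambda>a. h r (b \<otimes> a)", rotated 3])
      (simp_all add: hom_def that cl h_closed h_add left.r_distr h_phi
        phi_lact[symmetric] phi_balanced)
  have h_lact: "b \<triangleright> h r a = h (b \<triangleright> r) a"
    if "r \<in> carrier D" "a \<in> carrier R" "b \<in> carrier R" for r a b
    using that(2)
    by (rule eqI[where h = "\<lambda>a. b \<triangleright> h r a" and h' = "h (b \<triangleright> r)", rotated 3])
      (simp_all add: hom_def that cl h_closed h_add left.lact_add_right h_phi
        phi_lact left.lact_mult)
  have h_add_left: "h (r \<oplus>\<^bsub>D\<^esub> r') a = h r a \<oplus>\<^bsub>D\<^esub> h r' a"
    if "r \<in> carrier D" "r' \<in> carrier D" "a \<in> carrier R" for r r' a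
    using that(3)
    by (rule eqI[where h = "h (r \<oplus>\<^bsub>D\<^esub> r')" and h' = "\<lambda>a. h r a \<oplus>\<^bsub>D\<^esub> h r' a", rotated 3])
      (simp_all add: hom_def that cl h_closed h_add left.M.a_ac h_phi
        phi_add_left left.lact_add_left)
  show thesis
  proof (rule that[of "\<lambda>r. h r \<one>"])
    \<comment> \<open>Right linearity combines two laws:
      \<open>h (r \<triangleleft> b) \<one>\<close> and \<open>h r \<one> \<triangleleft> b\<close>
      both equal \<open>h r b\<close>.\<close>
    show "(\<lambda>r. h r \<one>) \<in> bimodule_hom R D D"
      by (simp add: bimodule_hom_def h_closed h_add_left h_lact h_ract h_balanced)
    show "\<phi> r s \<triangleright> t = h (r \<triangleleft> \<phi> s t) \<one>"
      if "r \<in> carrier D" "s \<in> carrier D" "t \<in> carrier D" for r s t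
      using that by (simp add: h_balanced h_phi cl)
  qed
qed

lemma psi_associative:
  assumes "r \<in> carrier D" "s \<in> carrier D" "t \<in> carrier D"
  shows "\<phi> r s \<triangleright> t = r \<triangleleft> \<phi> s t"
proof -
  note cl = left.lact_closed left.ract_closed phi_closed
  obtain \<theta> where \<theta>: "\<theta> \<in> bimodule_hom R D D"
    "\<And>r s t. r \<in> carrier D \<Longrightarrow> s \<in> carrier D \<Longrightarrow> t \<in> carrier D \<Longrightarrow> \<phi> r s \<triangleright> t = \<theta> (r \<triangleleft> \<phi> s t)"
    by (rule associator_endomorphism) blast
  obtain u where u: "u \<in> carrier R" and comm: "\<And>x. x \<in> carrier R \<Longrightarrow> x \<otimes> u = u \<otimes> x"
    and \<theta>_u: "\<And>f. f \<in> carrier D \<Longrightarrow> \<theta> f = u \<triangleright> f"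
    by (rule left.dual_endomorphism_central[OF fin_dim \<theta>(1)]) blast
  have assoc: "\<phi> r s \<triangleright> t = u \<triangleright> (r \<triangleleft> \<phi> s t)"
    if "r \<in> carrier D" "s \<in> carrier D" "t \<in> carrier D" for r s t
    using that by (simp add: \<theta>(2) \<theta>_u cl)
  have sym: "f \<triangleleft> u = u \<triangleright> f" if "f \<in> carrier D" for f
    using that u by (intro left.dual_eqI) (simp_all add: cl left.dual_simps comm)
  \<comment> \<open>The element \<open>u\<close> crosses the balanced tensor sign as a right factor
    of \<open>f\<close>, where it equals a left factor.\<close>
  have slide: "\<phi> f (u \<triangleright> g) = u \<otimes> \<phi> f g" if "f \<in> carrier D" "g \<in> carrier D" for f g
    using that u by (simp add: phi_balanced[symmetric] sym phi_lact)
  note eqI = phi_hom_eqI[OF ring.is_abelian_group[OF left.ring_axioms]]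

  txt \<open>Two reassociations of a fourfold product: \<open>u\<^sup>2 = 1\<close>.\<close>
  have square: "u \<otimes> (u \<otimes> (\<phi> r s \<otimes> \<phi> t w)) = \<phi> r s \<otimes> \<phi> t w"
    if "r \<in> carrier D" "s \<in> carrier D" "t \<in> carrier D" "w \<in> carrier D" for r s t w
  proof -
    have "\<phi> r s \<otimes> \<phi> t w = \<phi> (\<phi> r s \<triangleright> t) w"
      using that by (simp add: phi_lact cl)
    also have "\<dots> = u \<otimes> \<phi> (r \<triangleleft> \<phi> s t) w"
      using that u by (simp add: assoc phi_lact cl)
    \<comment> \<open>Balancedness moves \<open>\<phi> s t\<close> onto \<open>w\<close>;
      reassociating \<open>s\<close>, \<open>t\<close>, \<open>w\<close> produces the second
      \<open>u\<close>.\<close>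
    also have "\<dots> = u \<otimes> \<phi> r (u \<triangleright> (s \<triangleleft> \<phi> t w))"
      using that u by (simp add: phi_balanced assoc cl)
    also have "\<dots> = u \<otimes> (u \<otimes> (\<phi> r s \<otimes> \<phi> t w))"
      using that u by (simp add: slide phi_ract cl)
    finally show ?thesis by simp
  qed
  \<comment> \<open>The factors are cleared one at a time: \<open>\<phi> r s\<close> is replaced by
    an arbitrary \<open>p\<close>, then \<open>p = \<one>\<close> lets \<open>\<phi> t w\<close> be
    replaced by an arbitrary \<open>q\<close>.\<close>
  have square': "u \<otimes> (u \<otimes> (p \<otimes> \<phi> t w)) = p \<otimes> \<phi> t w"
    if "p \<in> carrier R" "t \<in> carrier D" "w \<in> carrier D" for p t w
    using that(1)
    by (rule eqI[where h = "\<lambda>p. u \<otimes> (u \<otimes> (p \<otimes> \<phi> t w))" and h' = "\<lambda>p. p \<otimes> \<phi> t w", rotated 3])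
      (simp_all add: hom_def that u cl square left.l_distr left.r_distr)
  have unit: "u \<otimes> (u \<otimes> q) = q" if "q \<in> carrier R" for q
    using that
    by (rule eqI[where h = "\<lambda>q. u \<otimes> (u \<otimes> q)" and h' = "\<lambda>q. q", rotated 3])
      (use square'[of \<one>] in \<open>simp_all add: hom_def u cl left.r_distr\<close>)

  txt \<open>Three cyclic rotations of \<open>t (\<phi> r s)\<close>: \<open>u\<^sup>3 = 1\<close>.\<close>
  have cyclic: "t (\<phi> r s) = r (u \<otimes> \<phi> s t)"
    if "r \<in> carrier D" "s \<in> carrier D" "t \<in> carrier D" for r s t
  proof -
    have "t (\<phi> r s) = (\<phi> r s \<triangleright> t) \<one>"
      using that by (simp add: left.dual_simps cl)
    also have "\<dots> = r (u \<otimes> \<phi> s t)"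
      using that u by (simp add: assoc left.dual_simps cl comm)
    finally show ?thesis .
  qed
  have fixed: "u \<otimes> \<phi> r s = \<phi> r s" if "r \<in> carrier D" "s \<in> carrier D" for r s
  proof (rule left.dual_separates[OF fin_dim])
    fix t assume t: "t \<in> carrier D"
    \<comment> \<open>Each of the first two rotations absorbs its \<open>u\<close> into the first
      argument of \<open>\<phi>\<close>, which readies the expression for the next one. After the
      third, the factor is the cube of \<open>u\<close>, which \<open>unit\<close> reduces to
      \<open>u\<close>.\<close>
    have "t (\<phi> r s) = r (\<phi> (u \<triangleright> s) t)"
      using that t u by (simp add: cyclic phi_lact)
    also have "\<dots> = (u \<triangleright> s) (\<phi> (u \<triangleright> t) r)"
      using that t u by (subst cyclic) (simp_all add: cl phi_lact)
    also have "\<dots> = (u \<triangleright> t) (u \<otimes> \<phi> r (u \<triangleright> s))"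
      using that t u by (subst cyclic) (simp_all add: cl)
    also have "\<dots> = t (u \<otimes> \<phi> r s)"
      using that t u by (simp add: cl slide left.dual_simps comm unit)
    finally show "t (u \<otimes> \<phi> r s) = t (\<phi> r s)" by simp
  qed (use that u cl in auto)
  \<comment> \<open>Multiplication by \<open>u\<close> fixes the values of \<open>\<phi>\<close>,
    which generate \<open>R\<close>, and hence fixes \<open>\<one>\<close>.\<close>
  have "u \<otimes> \<one> = \<one>"
    by (rule eqI[where h = "\<lambda>q. u \<otimes> q" and h' = "\<lambda>q. q"])
      (simp_all add: hom_def u fixed left.r_distr)
  then show ?thesis
    using assms u by (simp add: assoc left.lact_one cl)
qed

end

theorem propositionB:
  fixes K :: "('k, 'b) ring_scheme"
    and R :: "('k, 'r, 'a) module_scheme"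
    and \<psi> :: "(('r \<Rightarrow> 'k) \<times> ('r \<Rightarrow> 'k) \<Rightarrow>\<^sub>0 int) set \<Rightarrow> 'r"
  assumes "unital_algebra K R"
    and "vectorspace.fin_dim K R"
    and "invertible_bimodule K R (dual_bimodule K R)"
    and "iso_class K R (dual_bimodule K R) [^]\<^bsub>Pic K R\<^esub> (2::nat) = \<one>\<^bsub>Pic K R\<^esub>"
    and "\<psi> \<in> bimodule_iso R (tensor R (dual_bimodule K R) (dual_bimodule K R)) (regular_bimodule R)"
  shows "\<forall>r \<in> carrier (dual_bimodule K R). \<forall>s \<in> carrier (dual_bimodule K R).
    \<forall>t \<in> carrier (dual_bimodule K R).
      \<psi> (tensor_elem R (dual_bimodule K R) (dual_bimodule K R) r s) \<rightharpoonup>\<^bsub>dual_bimodule K R\<^esub> t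
    = r \<leftharpoonup>\<^bsub>dual_bimodule K R\<^esub> \<psi> (tensor_elem R (dual_bimodule K R) (dual_bimodule K R) s t)"
proof -
  \<comment> \<open>The bimodule laws of the dual are contained in its invertibility.\<close>
  have "bimodule K R (dual_bimodule K R)"
    using assms(3) by (simp add: invertible_bimodule_def)
  then interpret dual_square K R \<psi>
    using assms(2,5) by (intro dual_square.intro bimodule_tensor.intro dual_square_axioms.intro)
  show ?thesis
    using psi_associative by blast
qed

end
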